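(* Let $0<\alpha\le 1/3$, $0<\beta<1$, and $\delta:=\frac{\alpha\beta}{6}$. Then $\mathbf{Bad}(\delta)$ is an $(\alpha,\beta)$-winning set of $\mathbb{R}$.
   Context: For $\delta>0$, $\mathbf{Bad}(\delta)$ denotes the set of irrational real numbers $x$ for which there exists an integer $Q>0$ (depending on $x$) such that $|x-p/q|\ge \delta/q^2$ for all integers $q\ge Q$ and all integers $p$ coprime to $q$. Schmidt game: for a closed ball $B$ (positive radius, radius denoted $\rho(B)$) and $0<\gamma\le 1$, let $B^\gamma$ be the collection of closed balls $\widetilde B\subset B$ with $\rho(\widetilde B)=\gamma\rho(B)$. For $S\subset\mathbb{R}^d$ and $0<\alpha,\beta<1$, in the $(\alpha,\beta;S)$-game Bob chooses an arbitrary closed ball $B_1$, and then, for $n\ge1$, Alice chooses $A_n\in B_n^\alpha$ and Bob chooses $B_{n+1}\in A_n^\beta$. The intersection $\bigcap_{n} B_n$ is a single point. $S$ is an $(\alpha,\beta)$-winning set of $\mathbb{R}^d$ if Alice has a strategy ensuring, whatever Bob plays (including $B_1$), that this point lies in $S$. Here $d=1$ and closed balls are closed bounded intervals of positive length. *)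

theory Defs
  imports "HOL-Analysis.Analysis"
begin

definition Bad :: "real \<Rightarrow> real set" where
  "Bad \<delta> = {x. x \<notin> \<rat> \<and>
     (\<exists>Q::int. Q > 0 \<and>
       (\<forall>q p :: int. q \<ge> Q \<longrightarrow> coprime p q \<longrightarrow>
          \<bar>x - of_int p / of_int q\<bar> \<ge> \<delta> / (of_int q)\<^sup>2))}"

definition closed_ball :: "'a::euclidean_space set \<Rightarrow> bool" where
  "closed_ball B \<longleftrightarrow> (\<exists>c r. r > 0 \<and> B = cball c r)"

definition ball_radius :: "'a::euclidean_space set \<Rightarrow> real" where
  "ball_radius B = (THE r. r > 0 \<and> (\<exists>c. B = cball c r))"

lemma ball_radius_cball:
  fixes c :: "'a::euclidean_space"
  assumes "r > 0"
  shows "ball_radius (cball c r) = r"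
  unfolding ball_radius_def
  by (rule the_equality) (use assms in \<open>auto simp: cball_eq_cball_iff\<close>)

definition subballs :: "real \<Rightarrow> 'a::euclidean_space set \<Rightarrow> 'a set set" where
  "subballs \<gamma> B = {B'. closed_ball B' \<and> B' \<subseteq> B \<and> ball_radius B' = \<gamma> * ball_radius B}"

text \<open>
  A strategy for Alice maps the list of all moves made by Bob so far (the most recent one last)
  to her next move; her own earlier moves are determined by the strategy and so need not be
  recorded. The answer is required to be legal for every history ending in a closed ball, so
  Alice can never win by blocking the game. Requiring this also for histories that
  cannot occur is no restriction, since for \<open>0 < \<alpha> \<le> 1\<close> every closed ball has a legal answer.
\<close>

definition alice_strategy :: "real \<Rightarrow> ('a::euclidean_space set list \<Rightarrow> 'a set) \<Rightarrow> bool" where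
  "alice_strategy \<alpha> \<sigma> \<longleftrightarrow> (\<forall>Bs B. closed_ball B \<longrightarrow> \<sigma> (Bs @ [B]) \<in> subballs \<alpha> B)"

text \<open>
  Bob's moves against \<open>\<sigma>\<close>, indexed from \<open>0\<close>: the initial ball is \<open>B 0\<close>, and the list
  \<open>map B [0..<Suc n]\<close> is \<open>[B 0, \<dots>, B n]\<close>.
\<close>

definition bob_play ::
    "real \<Rightarrow> ('a::euclidean_space set list \<Rightarrow> 'a set) \<Rightarrow> (nat \<Rightarrow> 'a set) \<Rightarrow> bool" where
  "bob_play \<beta> \<sigma> B \<longleftrightarrow>
     closed_ball (B 0) \<and> (\<forall>n. B (Suc n) \<in> subballs \<beta> (\<sigma> (map B [0..<Suc n])))"

definition winning :: "real \<Rightarrow> real \<Rightarrow> 'a::euclidean_space set \<Rightarrow> bool" where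
  "winning \<alpha> \<beta> S \<longleftrightarrow>
     (\<exists>\<sigma>. alice_strategy \<alpha> \<sigma> \<and>
        (\<forall>B. bob_play \<beta> \<sigma> B \<longrightarrow> (\<exists>x\<in>S. (\<Inter>n. B n) = {x})))"

end

theory Submission
  imports Defs
begin

text \<open>
  Distinct rationals with denominators \<open>q\<close> satisfying \<open>2 \<rho> q\<^sup>2 < 1\<close> are more than \<open>2 \<rho>\<close> apart.
  So inside an interval of radius \<open>\<rho>\<close> Alice finds a subinterval of radius \<open>\<alpha> \<rho> \<le> \<rho> / 3\<close> whose
  points all have distance at least \<open>\<rho> / 3\<close> from every such rational. The radii of Bob's
  intervals are \<open>\<rho>\<^sub>n = (\<alpha> \<beta>)\<^sup>n \<rho>\<^sub>0\<close>, so every \<open>q\<close> is eventually dealt with and the outcome is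
  irrational. If \<open>n \<ge> 1\<close> is the first stage that deals with \<open>q\<close>, then \<open>2 \<rho>\<^sub>n\<^sub>-\<^sub>1 q\<^sup>2 \<ge> 1\<close>, whence
  the distance to \<open>p / q\<close> is at least \<open>\<rho>\<^sub>n / 3 = \<alpha> \<beta> \<rho>\<^sub>n\<^sub>-\<^sub>1 / 3 \<ge> \<alpha> \<beta> / (6 q\<^sup>2)\<close>.
\<close>

text \<open>\<open>\<rho>\<close> is meant to be the radius of Bob's ball, not of Alice's reply
  \<open>A\<close>, so it cannot be read off from \<open>A\<close> and is a separate
  argument.\<close>

definition avoids_fractions :: "real \<Rightarrow> real set \<Rightarrow> bool" where
  "avoids_fractions \<rho> A \<longleftrightarrow> (\<forall>x\<in>A. \<forall>p q :: int.
     q > 0 \<longrightarrow> 2 * \<rho> * (of_int q)\<^sup>2 < 1 \<longrightarrow> \<bar>x - of_int p / of_int q\<bar> \<ge> \<rho> / 3)"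

text \<open>The numerator \<open>p * q' - p' * q\<close> of the difference is a nonzero integer, so
  the fractions differ by at least \<open>1 / (q * q')\<close>. The product \<open>q * q'\<close> is
  at most the square of the larger denominator, hence below \<open>1 / (2 * \<rho>)\<close>.\<close>

lemma fraction_dist_gt:
  fixes p q p' q' :: int and \<rho> :: real
  assumes "\<rho> > 0" "q > 0" "q' > 0"
    and small: "2 * \<rho> * (of_int q)\<^sup>2 < 1" "2 * \<rho> * (of_int q')\<^sup>2 < 1"
    and ne: "of_int p / of_int q \<noteq> (of_int p' / of_int q' :: real)"
  shows "\<bar>of_int p / of_int q - of_int p' / of_int q'\<bar> > 2 * \<rho>"
proof -
  have "p * q' - p' * q \<noteq> 0"
  proof
    assume "p * q' - p' * q = 0"
    then have "real_of_int (p * q') = of_int (p' * q)" by simp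
    then show False using ne assms(2,3) by (simp add: field_simps)
  qed
  then have "1 \<le> \<bar>p * q' - p' * q\<bar>" by linarith
  then have num: "1 \<le> \<bar>of_int p * of_int q' - of_int p' * of_int q :: real\<bar>"
    by (metis of_int_1_le_iff of_int_abs of_int_diff of_int_mult)
  define m where "m = max q q'"
  have "2 * \<rho> * (of_int q * of_int q') \<le> 2 * \<rho> * (of_int m)\<^sup>2"
    unfolding power2_eq_square m_def using assms(1-3)
    by (intro mult_left_mono mult_mono) auto
  also have "\<dots> < 1" using small by (auto simp: m_def max_def)
  finally have den: "2 * \<rho> * (of_int q * of_int q') < 1" .
  have "2 * \<rho> < 1 / (of_int q * of_int q')"
    using den assms(2,3) by (simp add: field_simps)
  also have "\<dots> \<le> \<bar>of_int p * of_int q' - of_int p' * of_int q :: real\<bar> / (of_int q * of_int q')"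
    using num assms(2,3) by (intro divide_right_mono) auto
  also have "\<dots> = \<bar>(of_int p * of_int q' - of_int p' * of_int q) / (of_int q * of_int q')\<bar>"
    using assms(2,3) by (simp add: abs_divide)
  also have "(of_int p * of_int q' - of_int p' * of_int q) / (of_int q * of_int q')
      = of_int p / of_int q - (of_int p' / of_int q' :: real)"
    using assms(2,3) by (simp add: field_simps)
  finally show ?thesis .
qed

text \<open>Either \<open>b - 2 * t\<close> works, or some \<open>c\<close> in \<open>S\<close>
  obstructs it. Such a \<open>c\<close> lies strictly between \<open>b - 4 * t\<close> and
  \<open>b\<close>, so \<open>c + 2 * t\<close> is close enough to \<open>b\<close>; every other
  point of \<open>S\<close> is at least \<open>4 * t\<close> from \<open>c\<close>, hence at least
  \<open>2 * t\<close> from \<open>c + 2 * t\<close>.\<close>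

lemma exists_point_away_from_separated_set:
  fixes S :: "real set"
  assumes "t > 0" and sep: "\<And>x y. x \<in> S \<Longrightarrow> y \<in> S \<Longrightarrow> x \<noteq> y \<Longrightarrow> \<bar>x - y\<bar> \<ge> 4 * t"
  obtains a where "\<bar>a - b\<bar> \<le> 2 * t" "\<And>c. c \<in> S \<Longrightarrow> \<bar>a - c\<bar> \<ge> 2 * t"
proof (cases "\<exists>c\<in>S. \<bar>b - 2 * t - c\<bar> < 2 * t")
  case True
  then obtain c where c: "c \<in> S" "\<bar>b - 2 * t - c\<bar> < 2 * t" by blast
  show thesis
  proof (rule that[of "c + 2 * t"])
    show "\<bar>c + 2 * t - b\<bar> \<le> 2 * t" using c by linarith
    show "\<bar>c + 2 * t - d\<bar> \<ge> 2 * t" if "d \<in> S" for d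
      using sep[OF c(1) that] \<open>t > 0\<close> by (cases "c = d") auto
  qed
next
  case False
  then show thesis using \<open>t > 0\<close> by (intro that[of "b - 2 * t"]) force+
qed

lemma exists_good_subball:
  fixes B :: "real set"
  assumes "0 < \<alpha>" "\<alpha> \<le> 1/3" "closed_ball B"
  shows "\<exists>A \<in> subballs \<alpha> B. avoids_fractions (ball_radius B) A"
proof -
  obtain b \<rho> where \<rho>: "\<rho> > 0" and B: "B = cball b \<rho>"
    using assms(3) by (auto simp: closed_ball_def)
  define S where
    "S = {of_int p / of_int q :: real | p q :: int. q > 0 \<and> 2 * \<rho> * (of_int q)\<^sup>2 < 1}"
  have sep: "\<bar>x - y\<bar> \<ge> 4 * (\<rho> / 3)" if xy: "x \<in> S" "y \<in> S" "x \<noteq> y" for x y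
  proof -
    have "\<bar>x - y\<bar> > 2 * \<rho>"
      using xy unfolding S_def by (auto intro!: fraction_dist_gt[OF \<rho>])
    then show ?thesis using \<rho> by linarith
  qed
  \<comment> \<open>With \<open>t = \<rho> / 3\<close>, a ball of radius at most
    \<open>\<rho> / 3\<close> about \<open>a\<close> stays inside \<open>B\<close>, and its points
    keep \<open>\<rho> / 3\<close> of the distance \<open>2 * (\<rho> / 3)\<close> to each
    fraction.\<close>
  obtain a where a: "\<bar>a - b\<bar> \<le> 2 * (\<rho> / 3)" "\<And>c. c \<in> S \<Longrightarrow> \<bar>a - c\<bar> \<ge> 2 * (\<rho> / 3)"
    using exists_point_away_from_separated_set[OF _ sep, where b = b] \<rho> by auto
  have le: "\<alpha> * \<rho> \<le> \<rho> / 3" using assms(2) \<rho> by simp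
  have pos: "\<alpha> * \<rho> > 0" using assms(1) \<rho> by simp
  have "cball a (\<alpha> * \<rho>) \<subseteq> B"
  proof
    fix x assume "x \<in> cball a (\<alpha> * \<rho>)"
    then have "\<bar>a - x\<bar> \<le> \<alpha> * \<rho>" by (simp add: dist_real_def)
    then have "\<bar>b - x\<bar> \<le> \<rho>" using a(1) le by linarith
    then show "x \<in> B" by (simp add: B dist_real_def)
  qed
  then have sub: "cball a (\<alpha> * \<rho>) \<in> subballs \<alpha> B"
    using pos \<rho> by (auto simp: subballs_def closed_ball_def B ball_radius_cball)
  have "\<bar>x - of_int p / of_int q\<bar> \<ge> \<rho> / 3"
    if "x \<in> cball a (\<alpha> * \<rho>)" "q > 0" "2 * \<rho> * (of_int q)\<^sup>2 < 1" for x and p q :: int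
  proof -
    have "\<bar>a - of_int p / of_int q\<bar> \<ge> 2 * (\<rho> / 3)"
      using that by (intro a(2)) (auto simp: S_def)
    moreover have "\<bar>a - x\<bar> \<le> \<rho> / 3" using that(1) le by (simp add: dist_real_def)
    ultimately show ?thesis by linarith
  qed
  then have "avoids_fractions (ball_radius B) (cball a (\<alpha> * \<rho>))"
    using \<rho> by (simp add: avoids_fractions_def B ball_radius_cball)
  with sub show ?thesis by blast
qed

lemma bob_play_closed_ball:
  assumes "bob_play \<beta> \<sigma> B"
  shows "closed_ball (B n)"
  using assms by (cases n) (auto simp: bob_play_def subballs_def)

lemma alice_reply:
  assumes "alice_strategy \<alpha> \<sigma>" "bob_play \<beta> \<sigma> B"
  shows "\<sigma> (map B [0..<Suc n]) \<in> subballs \<alpha> (B n)"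
  using assms(1) bob_play_closed_ball[OF assms(2), of n] by (simp add: alice_strategy_def)

lemma bob_reply:
  assumes "bob_play \<beta> \<sigma> B"
  shows "B (Suc n) \<in> subballs \<beta> (\<sigma> (map B [0..<Suc n]))"
  using assms by (simp add: bob_play_def)

lemma play_radius:
  assumes "alice_strategy \<alpha> \<sigma>" "bob_play \<beta> \<sigma> B"
  shows "ball_radius (B n) = (\<alpha> * \<beta>) ^ n * ball_radius (B 0)"
proof (induction n)
  case (Suc n)
  have "ball_radius (B (Suc n)) = \<beta> * (\<alpha> * ball_radius (B n))"
    using alice_reply[OF assms, of n] bob_reply[OF assms(2), of n] by (simp add: subballs_def)
  then show ?case using Suc by simp
qed simp

text \<open>Cantor's intersection theorem: Bob's balls are nested closed sets whose diameters shrink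
  geometrically.\<close>

lemma play_outcome:
  fixes B :: "nat \<Rightarrow> 'a::euclidean_space set"
  assumes "alice_strategy \<alpha> \<sigma>" "bob_play \<beta> \<sigma> B" and ab: "0 \<le> \<alpha> * \<beta>" "\<alpha> * \<beta> < 1"
  obtains x where "(\<Inter>n. B n) = {x}"
proof -
  have cb: "closed_ball (B n)" for n using bob_play_closed_ball[OF assms(2)] .
  have step: "B (Suc n) \<subseteq> B n" for n
    using alice_reply[OF assms(1,2), of n] bob_reply[OF assms(2), of n]
    by (auto simp: subballs_def)
  have diam: "dist x y \<le> 2 * ball_radius (B n)" if "x \<in> B n" "y \<in> B n" for n x y
  proof -
    obtain c r where r: "r > 0" "B n = cball c r" using cb[of n] by (auto simp: closed_ball_def)
    then show ?thesis
      using that dist_triangle2[of x y c] by (simp add: ball_radius_cball dist_commute)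
  qed
  define r where "r = ball_radius (B 0)"
  have radius: "ball_radius (B n) = (\<alpha> * \<beta>) ^ n * r" for n
    unfolding r_def by (rule play_radius[OF assms(1,2)])
  have "(\<lambda>n. 2 * ((\<alpha> * \<beta>) ^ n * r)) \<longlonglongrightarrow> 2 * (0 * r)"
    using ab by (intro tendsto_intros LIMSEQ_power_zero) auto
  then have lim: "(\<lambda>n. 2 * ball_radius (B n)) \<longlonglongrightarrow> 0"
    by (simp add: radius)
  have "\<exists>x. (\<Inter>n. B n) = {x}"
  proof (rule decreasing_closed_nest_sing)
    show "closed (B n)" for n using cb[of n] by (auto simp: closed_ball_def)
    show "B n \<noteq> {}" for n using cb[of n] unfolding closed_ball_def
      by (metis cball_eq_empty less_asym)
    show "B n \<subseteq> B m" if "m \<le> n" for m n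
      using step that by (rule lift_Suc_antimono_le)
    show "\<exists>n. \<forall>x\<in>B n. \<forall>y\<in>B n. dist x y < e" if e: "e > 0" for e
    proof -
      obtain n where "2 * ball_radius (B n) < e"
        using order_tendstoD(2)[OF lim e] by (auto simp: eventually_sequentially)
      then show ?thesis using diam by (meson le_less_trans)
    qed
  qed
  then show thesis using that by blast
qed

text \<open>The arithmetic half of the argument, free of the game: \<open>s\<close> stands for
  \<open>\<alpha> * \<beta>\<close> and \<open>s ^ n * \<rho>\<close> for the radius of Bob's ball
  \<open>B n\<close>.\<close>

lemma Bad_if_far_from_fractions:
  fixes s \<rho> x :: real
  assumes "0 < s" "s < 1" "\<rho> > 0"
    and far: "\<And>n (p::int) (q::int). q > 0 \<Longrightarrow> 2 * (s ^ n * \<rho>) * (of_int q)\<^sup>2 < 1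
      \<Longrightarrow> \<bar>x - of_int p / of_int q\<bar> \<ge> s ^ n * \<rho> / 3"
  shows "x \<in> Bad (s / 6)"
proof -
  have ex: "\<exists>n. 2 * (s ^ n * \<rho>) * (of_int q)\<^sup>2 < 1" for q :: int
  proof -
    have "(\<lambda>n. 2 * (s ^ n * \<rho>) * (of_int q)\<^sup>2) \<longlonglongrightarrow> 2 * (0 * \<rho>) * (of_int q)\<^sup>2"
      using assms(1,2) by (intro tendsto_intros LIMSEQ_power_zero) auto
    then have "\<forall>\<^sub>F n in sequentially. 2 * (s ^ n * \<rho>) * (of_int q)\<^sup>2 < 1"
      by (rule order_tendstoD(2)) simp
    then show ?thesis by (auto simp: eventually_sequentially)
  qed
  have "x \<notin> \<rat>"
  proof
    assume "x \<in> \<rat>"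
    then obtain p q :: int where q: "q > 0" and x: "x = of_int p / of_int q"
      by (rule Rats_cases')
    obtain n where "2 * (s ^ n * \<rho>) * (of_int q)\<^sup>2 < 1" using ex by blast
    \<comment> \<open>A rational \<open>x\<close> would have distance 0 from itself.\<close>
    from far[OF q this, of p] have "s ^ n * \<rho> \<le> 0" by (simp add: x)
    moreover have "s ^ n * \<rho> > 0" using assms(1,3) by simp
    ultimately show False by linarith
  qed
  \<comment> \<open>\<open>Q\<close> is large enough that stage 0 does not deal with any
    \<open>q \<ge> Q\<close>, so the first stage that does has a predecessor.\<close>
  moreover define Q where "Q = max 1 \<lceil>1 / (2 * \<rho>)\<rceil>"
  have "\<bar>x - of_int p / of_int q\<bar> \<ge> (s / 6) / (of_int q)\<^sup>2" if "q \<ge> Q" for p q :: int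
  proof -
    have q: "q \<ge> 1" "1 / (2 * \<rho>) \<le> of_int q"
      using that by (auto simp: Q_def ceiling_le_iff)
    have "1 \<le> 2 * \<rho> * of_int q" using q(2) assms(3) by (simp add: field_simps)
    also have "\<dots> \<le> 2 * \<rho> * (of_int q)\<^sup>2"
      using q(1) assms(3) by (simp add: power2_eq_square)
    finally have zero: "\<not> 2 * (s ^ 0 * \<rho>) * (of_int q)\<^sup>2 < 1" by simp
    obtain n where n: "2 * (s ^ Suc n * \<rho>) * (of_int q)\<^sup>2 < 1"
      and n': "\<not> 2 * (s ^ n * \<rho>) * (of_int q)\<^sup>2 < 1"
      using ex_least_nat_less[of "\<lambda>n. 2 * (s ^ n * \<rho>) * (of_int q)\<^sup>2 < 1", OF _ zero] ex[of q]
      by (metis order_refl)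
    have "(s / 6) / (of_int q)\<^sup>2 \<le> s ^ Suc n * \<rho> / 3"
    proof -
      \<comment> \<open>The failure at stage \<open>n\<close>, multiplied by \<open>s\<close>,
        bounds the radius at stage \<open>Suc n\<close> from below.\<close>
      have "s * 1 \<le> s * (2 * (s ^ n * \<rho>) * (of_int q)\<^sup>2)"
        using n' assms(1) by (intro mult_left_mono) auto
      then show ?thesis using q(1) by (simp add: field_simps)
    qed
    also have "\<dots> \<le> \<bar>x - of_int p / of_int q\<bar>" using far[OF _ n] q(1) by simp
    finally show ?thesis .
  qed
  moreover have "Q > 0" by (simp add: Q_def)
  ultimately show ?thesis unfolding Bad_def by blast
qed

theorem theorem1p8:
  fixes \<alpha> \<beta> \<delta> :: real
  assumes "0 < \<alpha>" and "\<alpha> \<le> 1/3"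
    and "0 < \<beta>" and "\<beta> < 1"
    and "\<delta> = \<alpha> * \<beta> / 6"
  shows "winning \<alpha> \<beta> (Bad \<delta>)"
proof -
  have ab: "0 < \<alpha> * \<beta>" "\<alpha> * \<beta> < 1"
    using assms mult_strict_mono[of \<alpha> 1 \<beta> 1] by auto
  obtain f where f: "\<And>B. closed_ball B \<Longrightarrow> f B \<in> subballs \<alpha> B"
    "\<And>B. closed_ball B \<Longrightarrow> avoids_fractions (ball_radius B) (f B)"
    using exists_good_subball[OF assms(1,2)] by metis
  \<comment> \<open>A positional strategy: Alice looks only at Bob's latest ball.\<close>
  define \<sigma> where "\<sigma> = (\<lambda>Bs. f (last Bs))"
  have \<sigma>: "alice_strategy \<alpha> \<sigma>" by (simp add: alice_strategy_def \<sigma>_def f(1))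
  have "\<exists>x\<in>Bad \<delta>. (\<Inter>n. B n) = {x}" if B: "bob_play \<beta> \<sigma> B" for B
  proof -
    note cb = bob_play_closed_ball[OF B]
    obtain x where x: "(\<Inter>n. B n) = {x}"
      using play_outcome[OF \<sigma> B] ab by auto
    \<comment> \<open>The outcome lies in each of Alice's balls too, since Bob's next ball is inside
      her reply.\<close>
    have "x \<in> f (B n)" for n
    proof -
      have "x \<in> B (Suc n)" using x by blast
      then show ?thesis using bob_reply[OF B, of n] by (auto simp: subballs_def \<sigma>_def)
    qed
    then have far: "\<bar>x - of_int p / of_int q\<bar> \<ge> ball_radius (B n) / 3"
      if "q > 0" "2 * ball_radius (B n) * (of_int q)\<^sup>2 < 1" for n and p q :: int
      using f(2)[OF cb[of n]] that by (auto simp: avoids_fractions_def)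
    define r where "r = ball_radius (B 0)"
    have radius: "ball_radius (B n) = (\<alpha> * \<beta>) ^ n * r" for n
      unfolding r_def by (rule play_radius[OF \<sigma> B])
    have "r > 0" unfolding r_def using cb[of 0] by (auto simp: closed_ball_def ball_radius_cball)
    then have "x \<in> Bad (\<alpha> * \<beta> / 6)"
      by (rule Bad_if_far_from_fractions[OF ab _ far[unfolded radius]])
    then show ?thesis using x assms(5) by blast
  qed
  with \<sigma> show ?thesis unfolding winning_def by blast
qed

end
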